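(* Let $b\ge0$ be a locally integrable function on $\mathbb{R}^n$, $0<\beta<1$, $0\le\alpha<n$, $0<\alpha+\beta<n$ and $b\in\dot\Lambda_\beta(\mathbb{R}^n)$. Suppose that $\Phi,\Psi$ are Young functions, $\Phi\in\mathcal{Y}$, and there is a constant $C>0$ such that $t^{-\frac{\alpha+\beta}{n}}\Phi^{-1}(t)\le C\,\Psi^{-1}(t)$ for all $t>0$. Then $[b,M_\alpha]$ is bounded from $L^\Phi(\mathbb{R}^n)$ to $WL^\Psi(\mathbb{R}^n)$.
   Context: A Young function is a convex, left-continuous function $\Phi:[0,\infty)\to[0,\infty]$ with $\lim_{r\to0+}\Phi(r)=\Phi(0)=0$ and $\lim_{r\to\infty}\Phi(r)=\infty$. $\mathcal{Y}$ is the set of Young functions with $0<\Phi(r)<\infty$ for all $0<r<\infty$. For a Young function, $\Phi^{-1}(s)=\inf\{r\ge0:\Phi(r)>s\}$. The Orlicz space $L^\Phi(\mathbb{R}^n)$ is the set of $f\in L^1_{\rm loc}(\mathbb{R}^n)$ with $\int_{\mathbb{R}^n}\Phi(k|f(x)|)\,dx<\infty$ for some $k>0$, with norm $\|f\|_{L^\Phi}=\inf\{\lambda>0:\int_{\mathbb{R}^n}\Phi(|f(x)|/\lambda)\,dx\le1\}$. The weak Orlicz space $WL^\Phi(\mathbb{R}^n)$ is the set of $f\in L^1_{\rm loc}(\mathbb{R}^n)$ with $\|f\|_{WL^\Phi}<\infty$, where $\|f\|_{WL^\Phi}=\inf\{\lambda>0:\sup_{t>0}\Phi(t)\,|\{x\in\mathbb{R}^n:|f(x)|/\lambda>t\}|\le1\}$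 ($|E|$ is Lebesgue measure; $\infty\cdot0=0$). For $0\le\alpha<n$, $M_\alpha f(x)=\sup_{B\ni x}|B|^{-1+\frac{\alpha}{n}}\int_B|f(y)|\,dy$, the supremum being over all balls $B\subset\mathbb{R}^n$ containing $x$. The (nonlinear) commutator is $[b,M_\alpha](f)(x)=b(x)M_\alpha(f)(x)-M_\alpha(bf)(x)$. An operator $T$ is bounded from $X$ to $Y$ if there is a constant $C$ with $\|Tf\|_Y\le C\|f\|_X$ for all $f\in X$. For $0<\beta<1$, $b\in\dot\Lambda_\beta(\mathbb{R}^n)$ (Lipschitz space) means there is a constant $C$ with $|b(x)-b(y)|\le C|x-y|^\beta$ for all $x,y\in\mathbb{R}^n$. *)

theory Defs
  imports "HOL-Analysis.Analysis"
begin

text \<open>Functions on \<open>[0,\<infinity>)\<close> are represented by functions on \<open>real\<close> whose values at negative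
  arguments are irrelevant.\<close>

definition young_function :: "(real \<Rightarrow> ennreal) \<Rightarrow> bool" where
  "young_function \<Phi> \<longleftrightarrow>
     (\<forall>x\<ge>0. \<forall>y\<ge>0. \<forall>u\<in>{0..1}.
        \<Phi> ((1 - u) * x + u * y) \<le> ennreal (1 - u) * \<Phi> x + ennreal u * \<Phi> y) \<and>
     (\<forall>r>0. (\<Phi> \<longlongrightarrow> \<Phi> r) (at_left r)) \<and>
     \<Phi> 0 = 0 \<and> (\<Phi> \<longlongrightarrow> 0) (at_right 0) \<and>
     (\<Phi> \<longlongrightarrow> \<infinity>) at_top"

definition young_class_Y :: "(real \<Rightarrow> ennreal) set" where
  "young_class_Y = {\<Phi>. young_function \<Phi> \<and> (\<forall>r>0. 0 < \<Phi> r \<and> \<Phi> r < \<infinity>)}"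

text \<open>For a Young function and real \<open>s\<close> the set below is nonempty (as \<open>\<Phi>\<close> tends to \<open>\<infinity>\<close>) and bounded
  below, so the real infimum is the true one.\<close>

definition young_inverse :: "(real \<Rightarrow> ennreal) \<Rightarrow> real \<Rightarrow> real" where
  "young_inverse \<Phi> s = Inf {r. 0 \<le> r \<and> ennreal s < \<Phi> r}"

text \<open>Functions produced by the maximal operator may be infinite on a null set, so local
  integrability and the weak Orlicz space are formulated for extended-real-valued functions.\<close>

definition L1_loc :: "('a::euclidean_space \<Rightarrow> ereal) set" where
  "L1_loc = {g. g \<in> borel_measurable lebesgue \<and>
     (\<forall>K. compact K \<longrightarrow> (\<integral>\<^sup>+x\<in>K. e2ennreal \<bar>g x\<bar> \<partial>lebesgue) < \<infinity>)}"

definition orlicz_space :: "(real \<Rightarrow> ennreal) \<Rightarrow> ('a::euclidean_space \<Rightarrow> real) set" where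
  "orlicz_space \<Phi> = {f. (\<lambda>x. ereal (f x)) \<in> L1_loc \<and>
     (\<exists>k>0. (\<integral>\<^sup>+x. \<Phi> (k * \<bar>f x\<bar>) \<partial>lebesgue) < \<infinity>)}"

definition orlicz_norm :: "(real \<Rightarrow> ennreal) \<Rightarrow> ('a::euclidean_space \<Rightarrow> real) \<Rightarrow> ennreal" where
  "orlicz_norm \<Phi> f =
     Inf {ennreal l | l. 0 < l \<and> (\<integral>\<^sup>+x. \<Phi> (\<bar>f x\<bar> / l) \<partial>lebesgue) \<le> 1}"

definition weak_orlicz_norm :: "(real \<Rightarrow> ennreal) \<Rightarrow> ('a::euclidean_space \<Rightarrow> ereal) \<Rightarrow> ennreal" where
  "weak_orlicz_norm \<Phi> g =
     Inf {ennreal l | l. 0 < l \<and>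
       (SUP t\<in>{0<..}. \<Phi> t * emeasure lebesgue {x. \<bar>g x\<bar> / ereal l > ereal t}) \<le> 1}"

definition weak_orlicz_space :: "(real \<Rightarrow> ennreal) \<Rightarrow> ('a::euclidean_space \<Rightarrow> ereal) set" where
  "weak_orlicz_space \<Phi> = {g \<in> L1_loc. weak_orlicz_norm \<Phi> g < \<infinity>}"

definition frac_maximal :: "real \<Rightarrow> ('a::euclidean_space \<Rightarrow> real) \<Rightarrow> 'a \<Rightarrow> ennreal" where
  "frac_maximal \<alpha> f x =
     (SUP (c, r) \<in> {(c, r). 0 < r \<and> x \<in> ball c r}.
        ennreal (measure lebesgue (ball c r) powr (- 1 + \<alpha> / DIM('a))) *
        (\<integral>\<^sup>+y\<in>ball c r. ennreal \<bar>f y\<bar> \<partial>lebesgue))"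

text \<open>In \<open>ereal\<close> one has \<open>\<infinity> - \<infinity> = \<infinity>\<close>, so an indeterminate difference can only enlarge the
  weak Orlicz norm of the commutator.\<close>

definition max_commutator ::
    "real \<Rightarrow> ('a::euclidean_space \<Rightarrow> real) \<Rightarrow> ('a \<Rightarrow> real) \<Rightarrow> 'a \<Rightarrow> ereal" where
  "max_commutator \<alpha> b f x =
     ereal (b x) * enn2ereal (frac_maximal \<alpha> f x)
       - enn2ereal (frac_maximal \<alpha> (\<lambda>y. b y * f y) x)"

definition bounded_operator ::
    "'f set \<Rightarrow> ('f \<Rightarrow> ennreal) \<Rightarrow> 'g set \<Rightarrow> ('g \<Rightarrow> ennreal) \<Rightarrow> ('f \<Rightarrow> 'g) \<Rightarrow> bool" where
  "bounded_operator X normX Y normY T \<longleftrightarrow>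
     (\<exists>C\<ge>0. \<forall>f\<in>X. T f \<in> Y \<and> normY (T f) \<le> ennreal C * normX f)"

definition lipschitz_space :: "real \<Rightarrow> ('a::euclidean_space \<Rightarrow> real) set" where
  "lipschitz_space \<beta> = {b. \<exists>C. \<forall>x y. \<bar>b x - b y\<bar> \<le> C * norm (x - y) powr \<beta>}"

end

theory Submission
  imports Defs
begin

text \<open>
  Put \<open>\<gamma> = \<alpha> + \<beta>\<close>. The Lipschitz condition gives \<open>|[b, M\<^sub>\<alpha>] f| \<le> L M\<^sub>\<gamma> f\<close> wherever \<open>M\<^sub>\<alpha> f\<close> is
  finite. If \<open>\<integral> \<Phi>(|f|) \<le> 1\<close> and a ball \<open>B\<close> satisfies \<open>|B|\<^sup>\<gamma>\<^sup>/\<^sup>n \<cdot> avg\<^sub>B |f| > 2 C t\<close>, put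
  \<open>a = \<integral>\<^sub>B \<Phi>(|f|) \<le> 1\<close>. Convexity bounds half of the average by \<open>\<Phi>\<^sup>-\<^sup>1(a / |B|)\<close>, and the hypothesis on
  the inverses at \<open>a / |B|\<close> then gives \<open>t < \<Psi>\<^sup>-\<^sup>1(a / |B|)\<close>, that is \<open>\<Psi>(t) |B| \<le> \<integral>\<^sub>B \<Phi>(|f|)\<close>. Summing over
  a Vitali subfamily yields \<open>\<Psi>(t) |{M\<^sub>\<gamma> f > 2 C t}| \<le> 5\<^sup>n\<close>, and convexity of \<open>\<Psi>\<close> absorbs \<open>5\<^sup>n\<close> into the
  constant. The same covering argument shows that \<open>M\<^sub>\<alpha> f\<close> is finite almost everywhere. Local
  integrability of the commutator does not follow from the weak bound (\<open>\<Psi>\<close> may grow only linearly):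
  it comes from the weak type \<open>(1, n / (n - \<gamma>))\<close> estimate for the balls of measure less than one, while
  the means over larger balls are uniformly bounded.
\<close>

section \<open>Covering by balls\<close>

lemma lebesgue_ball:
  fixes c :: "'a::euclidean_space"
  assumes "0 < r"
  shows measure_lebesgue_ball:
      "measure lebesgue (ball c r) = unit_ball_vol (real DIM('a)) * r ^ DIM('a)"
    and measure_lebesgue_ball_pos: "0 < measure lebesgue (ball c r)"
    and emeasure_lebesgue_ball:
      "emeasure lebesgue (ball c r) = ennreal (measure lebesgue (ball c r))"
proof -
  show m: "measure lebesgue (ball c r) = unit_ball_vol (real DIM('a)) * r ^ DIM('a)"
    using assms by (simp add: content_ball)
  show "0 < measure lebesgue (ball c r)"
    unfolding m using assms by simp
  show "emeasure lebesgue (ball c r) = ennreal (measure lebesgue (ball c r))"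
    unfolding m using assms by (simp add: emeasure_ball)
qed

lemma open_sets_lebesgue: "open S \<Longrightarrow> S \<in> sets lebesgue"
  by (simp add: borel_open)

lemma ball_sets_lebesgue [measurable]: "ball c r \<in> sets lebesgue"
  by simp

text \<open>Countable subadditivity with the sum written as an integral over
  \<open>count_space I\<close>, so that no enumeration of the index set is required. The indicator
  of a union is at most the sum of the indicators, and Tonelli exchanges sum and integral.\<close>

lemma emeasure_UN_le_nn_integral:
  assumes I: "countable I" and A: "\<And>i. i \<in> I \<Longrightarrow> A i \<in> sets M"
  shows "emeasure M (\<Union>i\<in>I. A i) \<le> (\<integral>\<^sup>+i. emeasure M (A i) \<partial>count_space I)"
proof -
  have "(\<Union>i\<in>I. A i) \<in> sets M"
    using I A by auto
  then have "emeasure M (\<Union>i\<in>I. A i) = (\<integral>\<^sup>+x. indicator (\<Union>i\<in>I. A i) x \<partial>M)"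
    by simp
  also have "\<dots> \<le> (\<integral>\<^sup>+x. (\<integral>\<^sup>+i. indicator (A i) x \<partial>count_space I) \<partial>M)"
  proof (rule nn_integral_mono)
    fix x
    show "indicator (\<Union>i\<in>I. A i) x \<le> (\<integral>\<^sup>+i. indicator (A i) x \<partial>count_space I :: ennreal)"
    proof (cases "x \<in> (\<Union>i\<in>I. A i)")
      case True
      then obtain j where j: "j \<in> I" "x \<in> A j" by auto
      have "(1::ennreal) = (\<integral>\<^sup>+i. indicator {j} i \<partial>count_space I)"
        using j by (subst nn_integral_indicator) auto
      also have "\<dots> \<le> (\<integral>\<^sup>+i. indicator (A i) x \<partial>count_space I)"
        using j by (intro nn_integral_mono) (auto simp: indicator_def)
      finally show ?thesis
        using True by simp
    qed simp
  qed
  also have "\<dots> = (\<integral>\<^sup>+i. (\<integral>\<^sup>+x. indicator (A i) x \<partial>M) \<partial>count_space I)"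
    using I A by (intro nn_integral_count_space_nn_integral) auto
  also have "\<dots> = (\<integral>\<^sup>+i. emeasure M (A i) \<partial>count_space I)"
    using A by (intro nn_integral_cong) auto
  finally show ?thesis .
qed

text \<open>The common source of the weak type estimates below. Each ball of \<open>W\<close>
  carries \<open>g\<close>-mass at least \<open>k\<close> times its measure; for a disjoint
  subfamily these masses add up to at most the total mass, and its fivefold enlargements still cover
  the union.\<close>

lemma vitali_weak_bound:
  fixes g :: "'a::euclidean_space \<Rightarrow> ennreal"
  assumes g [measurable]: "g \<in> borel_measurable lebesgue"
    and fin: "(\<integral>\<^sup>+x. g x \<partial>lebesgue) < \<infinity>"
    and k: "0 < k"
    and W: "\<And>c r. (c, r) \<in> W \<Longrightarrow> 0 < r"
    and kW: "\<And>c r. (c, r) \<in> W \<Longrightarrow>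
      ennreal k * emeasure lebesgue (ball c r) \<le> (\<integral>\<^sup>+x\<in>ball c r. g x \<partial>lebesgue)"
  shows "ennreal k * emeasure lebesgue (\<Union>(c, r)\<in>W. ball c r)
    \<le> 5 ^ DIM('a) * (\<integral>\<^sup>+x. g x \<partial>lebesgue)"
proof -
  define J where "J = enn2real (\<integral>\<^sup>+x. g x \<partial>lebesgue)"
  have J: "(\<integral>\<^sup>+x. g x \<partial>lebesgue) = ennreal J" "0 \<le> J"
    using fin by (auto simp: J_def)
  define v where "v = unit_ball_vol (real DIM('a))"
  have v: "0 < v" by (simp add: v_def)
  \<comment> \<open>Vitali's lemma requires bounded radii. The total mass \<open>J\<close> bounds
    \<open>k * v * r ^ n\<close>, and \<open>r \<le> r ^ n\<close> as soon as \<open>r\<close> is at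
    least one.\<close>
  have rad: "0 < snd i \<and> snd i \<le> max 1 (J / (k * v))" if "i \<in> W" for i
  proof -
    obtain c r where i: "i = (c, r)" by force
    have r: "0 < r" using W that i by auto
    have "ennreal (k * (v * r ^ DIM('a))) = ennreal k * emeasure lebesgue (ball c r)"
      unfolding emeasure_lebesgue_ball[OF r] measure_lebesgue_ball[OF r] v_def
      using k r by (simp add: ennreal_mult)
    also have "\<dots> \<le> (\<integral>\<^sup>+x\<in>ball c r. g x \<partial>lebesgue)"
      using kW that i by auto
    also have "\<dots> \<le> (\<integral>\<^sup>+x. g x \<partial>lebesgue)"
      by (intro nn_integral_mono) (auto simp: indicator_def)
    finally have "k * (v * r ^ DIM('a)) \<le> J"
      using J by simp
    then have *: "r ^ DIM('a) \<le> J / (k * v)"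
      using k v by (simp add: field_simps)
    have "r \<le> r ^ DIM('a)" if "1 \<le> r"
      using that by (simp add: self_le_power)
    then show ?thesis
      using r * i by force
  qed
  obtain C where C: "countable C" "C \<subseteq> W"
    and dis: "pairwise (\<lambda>i j. disjnt (ball (fst i) (snd i)) (ball (fst j) (snd j))) C"
    and cov: "(\<Union>(c, r)\<in>W. ball c r) \<subseteq> (\<Union>i\<in>C. ball (fst i) (5 * snd i))"
  proof (rule Vitali_covering_lemma_balls[where K = W and a = fst and r = snd])
    show "(\<Union>(c, r)\<in>W. ball c r) \<subseteq> (\<Union>i\<in>W. ball (fst i) (snd i))"
      by auto
  qed (use rad in auto)
  have "emeasure lebesgue (\<Union>(c, r)\<in>W. ball c r)
      \<le> emeasure lebesgue (\<Union>i\<in>C. ball (fst i) (5 * snd i))"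
    using cov by (intro emeasure_mono) (auto intro!: open_sets_lebesgue open_UN)
  also have "\<dots> \<le> (\<integral>\<^sup>+i. emeasure lebesgue (ball (fst i) (5 * snd i)) \<partial>count_space C)"
    using C by (intro emeasure_UN_le_nn_integral) auto
  finally have "ennreal k * emeasure lebesgue (\<Union>(c, r)\<in>W. ball c r)
    \<le> ennreal k * (\<integral>\<^sup>+i. emeasure lebesgue (ball (fst i) (5 * snd i)) \<partial>count_space C)"
    by (rule mult_left_mono) simp
  also have "\<dots> = (\<integral>\<^sup>+i. ennreal k * emeasure lebesgue (ball (fst i) (5 * snd i)) \<partial>count_space C)"
    by (simp add: nn_integral_cmult)
  \<comment> \<open>Ball integrals of \<open>g\<close> are read as values of the measure
    \<open>density lebesgue g\<close>, whose countable additivity then sums them over the disjoint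
    balls.\<close>
  also have "\<dots> \<le> (\<integral>\<^sup>+i. 5 ^ DIM('a) * emeasure (density lebesgue g) (ball (fst i) (snd i)) \<partial>count_space C)"
  proof (rule nn_integral_mono)
    fix i assume "i \<in> space (count_space C)"
    then have iW: "(fst i, snd i) \<in> W" using C by auto
    have r: "0 < snd i" using W[OF iW] .
    have "ennreal k * emeasure lebesgue (ball (fst i) (5 * snd i))
        = ennreal (5 ^ DIM('a)) * (ennreal k * emeasure lebesgue (ball (fst i) (snd i)))"
    proof -
      have r5: "0 < 5 * snd i" using r by simp
      show ?thesis
        unfolding emeasure_lebesgue_ball[OF r] measure_lebesgue_ball[OF r]
          emeasure_lebesgue_ball[OF r5] measure_lebesgue_ball[OF r5]
        using r k by (simp add: power_mult_distrib mult_ac flip: ennreal_mult)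
    qed
    also have "\<dots> \<le> ennreal (5 ^ DIM('a)) * emeasure (density lebesgue g) (ball (fst i) (snd i))"
      using kW[OF iW] by (intro mult_left_mono) (auto simp: emeasure_density)
    finally show "ennreal k * emeasure lebesgue (ball (fst i) (5 * snd i))
        \<le> 5 ^ DIM('a) * emeasure (density lebesgue g) (ball (fst i) (snd i))"
      by (simp flip: ennreal_power)
  qed
  also have "\<dots> = 5 ^ DIM('a) * (\<integral>\<^sup>+i. emeasure (density lebesgue g) (ball (fst i) (snd i)) \<partial>count_space C)"
    by (simp add: nn_integral_cmult)
  also have "(\<integral>\<^sup>+i. emeasure (density lebesgue g) (ball (fst i) (snd i)) \<partial>count_space C)
      = emeasure (density lebesgue g) (\<Union>i\<in>C. ball (fst i) (snd i))"
    using C dis by (intro emeasure_UN_countable[symmetric])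
      (auto simp: disjoint_family_on_def pairwise_def disjnt_def)
  also have "\<dots> \<le> emeasure (density lebesgue g) UNIV"
    by (intro emeasure_mono) auto
  also have "\<dots> = (\<integral>\<^sup>+x. g x \<partial>lebesgue)"
    by (simp add: emeasure_density)
  finally show ?thesis
    by (simp add: mult_left_mono)
qed

section \<open>Young functions\<close>

text \<open>Convexity on the segment from \<open>0\<close> to \<open>x\<close>, with
  \<open>\<Phi> 0 = 0\<close>. Monotonicity and the absorption of constants both rest on it.\<close>

lemma young_function_scale:
  assumes "young_function \<Phi>" "0 \<le> u" "u \<le> 1" "0 \<le> x"
  shows "\<Phi> (u * x) \<le> ennreal u * \<Phi> x"
proof -
  have "\<Phi> ((1 - u) * 0 + u * x) \<le> ennreal (1 - u) * \<Phi> 0 + ennreal u * \<Phi> x"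
    using assms unfolding young_function_def by (metis atLeastAtMost_iff order_refl)
  then show ?thesis
    using assms by (simp add: young_function_def)
qed

lemma young_function_mono:
  assumes \<Phi>: "young_function \<Phi>" and "0 \<le> x" "x \<le> y"
  shows "\<Phi> x \<le> \<Phi> y"
proof (cases "y = 0")
  case False
  then have "\<Phi> (x / y * y) \<le> ennreal (x / y) * \<Phi> y"
    using assms by (intro young_function_scale) auto
  also have "\<dots> \<le> 1 * \<Phi> y"
    using assms False by (intro mult_right_mono) (auto simp: ennreal_le_1)
  finally show ?thesis
    using False by simp
qed (use assms in auto)

lemma young_function_exists_gt:
  assumes "young_function \<Phi>"
  obtains t where "0 < t" "ennreal a < \<Phi> t"
proof -
  have "(\<Phi> \<longlongrightarrow> \<infinity>) at_top"
    using assms by (simp add: young_function_def)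
  then have "\<forall>\<^sub>F t in at_top. ennreal a < \<Phi> t"
    by (rule order_tendstoD) simp
  then have "\<forall>\<^sub>F t in at_top. ennreal a < \<Phi> t \<and> 0 < t"
    by (intro eventually_conj eventually_gt_at_top)
  then show ?thesis
    using that by (auto dest!: eventually_happens)
qed

text \<open>By monotonicity no \<open>r\<close> with \<open>\<Phi> r > s\<close> lies below
  \<open>z\<close>. The growth of \<open>\<Phi>\<close> at infinity makes the set of such
  \<open>r\<close> nonempty, without which the real infimum would be meaningless.\<close>

lemma le_young_inverse:
  assumes \<Phi>: "young_function \<Phi>" and "0 \<le> z" "\<Phi> z \<le> ennreal s"
  shows "z \<le> young_inverse \<Phi> s"
  unfolding young_inverse_def
proof (rule cInf_greatest)
  show "{r. 0 \<le> r \<and> ennreal s < \<Phi> r} \<noteq> {}"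
    using young_function_exists_gt[OF \<Phi>, of s] by force
  fix r assume "r \<in> {r. 0 \<le> r \<and> ennreal s < \<Phi> r}"
  then show "z \<le> r"
    using young_function_mono[OF \<Phi>, of r z] assms by (force simp: not_le)
qed

lemma less_young_inverseD:
  assumes "0 \<le> t" "t < young_inverse \<Psi> s"
  shows "\<Psi> t \<le> ennreal s"
proof (rule ccontr)
  assume "\<not> \<Psi> t \<le> ennreal s"
  then have "young_inverse \<Psi> s \<le> t"
    unfolding young_inverse_def using assms
    by (intro cInf_lower) (auto simp: not_le intro: bdd_belowI)
  then show False using assms by simp
qed

text \<open>A bound on \<open>y\<close> that is affine in \<open>\<Phi> y\<close>: for
  \<open>y \<le> z\<close> the first summand suffices, and for \<open>y > z\<close> the quotient
  \<open>\<Phi> z / z\<close> is at most \<open>\<Phi> y / y\<close>. Integrating it replaces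
  Jensen's inequality.\<close>

lemma young_function_mult_le:
  assumes \<Phi>: "young_function \<Phi>" and "0 \<le> y" "0 \<le> z"
  shows "ennreal y * \<Phi> z \<le> ennreal z * \<Phi> z + ennreal z * \<Phi> y"
proof (cases "y \<le> z")
  case True
  then have "ennreal y * \<Phi> z \<le> ennreal z * \<Phi> z"
    using assms by (intro mult_right_mono) (auto simp: ennreal_leI)
  then show ?thesis
    by (simp add: add_increasing2)
next
  case False
  then have "\<Phi> (z / y * y) \<le> ennreal (z / y) * \<Phi> y"
    using assms by (intro young_function_scale) auto
  then have "ennreal y * \<Phi> z \<le> ennreal y * (ennreal (z / y) * \<Phi> y)"
    using False assms by (intro mult_left_mono) auto
  also have "\<dots> = ennreal z * \<Phi> y"
    using False assms by (simp flip: mult.assoc ennreal_mult)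
  finally show ?thesis
    by (simp add: add_increasing)
qed

lemma young_class_Y_D:
  assumes "\<Phi> \<in> young_class_Y"
  shows "young_function \<Phi>" and "0 < r \<Longrightarrow> 0 < \<Phi> r" and "0 \<le> r \<Longrightarrow> \<Phi> r < \<infinity>"
proof -
  show \<Phi>: "young_function \<Phi>" and "0 < r \<Longrightarrow> 0 < \<Phi> r"
    using assms by (auto simp: young_class_Y_def)
  have "\<Phi> 0 = 0"
    using \<Phi> by (simp add: young_function_def)
  then show "0 \<le> r \<Longrightarrow> \<Phi> r < \<infinity>"
    using assms by (cases "r = 0") (auto simp: young_class_Y_def)
qed

text \<open>A monotone real function is Borel. Clamping the argument at \<open>0\<close> avoids the
  arbitrary values of \<open>\<Phi>\<close> on negative numbers, and finiteness on the class
  \<open>young_class_Y\<close> allows the passage to real values.\<close>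

lemma borel_measurable_young:
  assumes \<Phi>: "\<Phi> \<in> young_class_Y" and f [measurable]: "f \<in> borel_measurable M"
    and l: "0 < l"
  shows "(\<lambda>x. \<Phi> (\<bar>f x\<bar> / l)) \<in> borel_measurable M"
proof -
  have "mono (\<lambda>x. enn2real (\<Phi> (max 0 x)))"
    using young_class_Y_D[OF \<Phi>]
    by (intro monoI enn2real_mono young_function_mono) auto
  then have [measurable]: "(\<lambda>x. enn2real (\<Phi> (max 0 x))) \<in> borel_measurable borel"
    by (rule borel_measurable_mono)
  have "\<Phi> (\<bar>f x\<bar> / l) = ennreal (enn2real (\<Phi> (max 0 (\<bar>f x\<bar> / l))))" for x
    using young_class_Y_D(3)[OF \<Phi>, of "\<bar>f x\<bar> / l"] l by simp
  then show ?thesis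
    by simp
qed


text \<open>A substitute for Jensen's inequality, at the cost of a factor \<open>2\<close>.\<close>

lemma young_mean_bound:
  fixes f :: "'a::euclidean_space \<Rightarrow> real"
  assumes \<Phi>: "\<Phi> \<in> young_class_Y" and f [measurable]: "f \<in> borel_measurable lebesgue"
    and "0 < l" "0 < z" "0 < r"
    and le: "ennreal (2 * z * l) * emeasure lebesgue (ball c r)
      \<le> (\<integral>\<^sup>+y\<in>ball c r. ennreal \<bar>f y\<bar> \<partial>lebesgue)"
  shows "\<Phi> z * emeasure lebesgue (ball c r) \<le> (\<integral>\<^sup>+y\<in>ball c r. \<Phi> (\<bar>f y\<bar> / l) \<partial>lebesgue)"
    (is "_ \<le> ?A")
proof (cases "?A = \<infinity>")
  case False
  define V where "V = measure lebesgue (ball c r)"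
  have V: "0 < V" "emeasure lebesgue (ball c r) = ennreal V"
    unfolding V_def using \<open>0 < r\<close> by (rule measure_lebesgue_ball_pos emeasure_lebesgue_ball)+
  define a where "a = enn2real ?A"
  have a: "?A = ennreal a" "0 \<le> a"
    using False by (auto simp: a_def less_top)
  define p where "p = enn2real (\<Phi> z)"
  have p: "\<Phi> z = ennreal p" "0 \<le> p"
    using young_class_Y_D(3)[OF \<Phi>, of z] \<open>0 < z\<close> by (auto simp: p_def)
  have [measurable]: "(\<lambda>y. \<Phi> (\<bar>f y\<bar> / l)) \<in> borel_measurable lebesgue"
    by (rule borel_measurable_young[OF \<Phi> f \<open>0 < l\<close>])
  \<comment> \<open>This is \<open>young_function_mult_le\<close> at \<open>y = |f y| / l\<close>,
    multiplied by \<open>l\<close>.\<close>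
  have pt: "ennreal p * ennreal \<bar>f y\<bar> \<le> ennreal (l * z * p) + ennreal (l * z) * \<Phi> (\<bar>f y\<bar> / l)" for y
  proof -
    have "ennreal p * ennreal \<bar>f y\<bar> = ennreal l * (ennreal (\<bar>f y\<bar> / l) * \<Phi> z)"
      using \<open>0 < l\<close> p by (simp flip: ennreal_mult)
    also have "\<dots> \<le> ennreal l * (ennreal z * \<Phi> z + ennreal z * \<Phi> (\<bar>f y\<bar> / l))"
      using assms by (intro mult_left_mono young_function_mult_le young_class_Y_D) auto
    also have "\<dots> = ennreal (l * z * p) + ennreal (l * z) * \<Phi> (\<bar>f y\<bar> / l)"
      using assms p by (simp add: distrib_left ennreal_mult mult.assoc)
    finally show ?thesis .
  qed
  have "ennreal (p * (2 * z * l * V)) = ennreal p * (ennreal (2 * z * l) * emeasure lebesgue (ball c r))"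
    unfolding V using V p assms by (simp flip: ennreal_mult)
  also have "\<dots> \<le> ennreal p * (\<integral>\<^sup>+y\<in>ball c r. ennreal \<bar>f y\<bar> \<partial>lebesgue)"
    using le by (intro mult_left_mono) auto
  also have "\<dots> = (\<integral>\<^sup>+y\<in>ball c r. ennreal p * ennreal \<bar>f y\<bar> \<partial>lebesgue)"
    by (subst nn_integral_cmult[symmetric]) (auto simp: mult.assoc)
  also have "\<dots> \<le> (\<integral>\<^sup>+y. ennreal (l * z * p) * indicator (ball c r) y
      + ennreal (l * z) * (\<Phi> (\<bar>f y\<bar> / l) * indicator (ball c r) y) \<partial>lebesgue)"
    using pt by (intro nn_integral_mono) (auto simp: indicator_def)
  also have "\<dots> = ennreal (l * z * p) * ennreal V + ennreal (l * z) * ennreal a"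
    unfolding V(2)[symmetric] a(1)[symmetric]
    by (subst nn_integral_add) (auto simp: nn_integral_cmult)
  also have "\<dots> = ennreal (l * z * p * V + l * z * a)"
    using assms p a V by (simp flip: ennreal_mult ennreal_plus)
  finally have "p * (2 * z * l * V) \<le> l * z * p * V + l * z * a"
    using assms p a V by (subst (asm) ennreal_le_iff) auto
  \<comment> \<open>One of the two copies of \<open>l * z * p * V\<close> on the left cancels the
    constant term; this is where the factor \<open>2\<close> in the hypothesis is spent.\<close>
  then have "(l * z) * (p * V) \<le> (l * z) * a"
    by (simp add: algebra_simps)
  then have "p * V \<le> a"
    using assms by simp
  then have "ennreal (p * V) \<le> ennreal a"
    by (rule ennreal_leI)
  then show ?thesis
    unfolding a p V using p V by (simp add: ennreal_mult)
qed simp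

section \<open>Fractional maximal function and commutator\<close>

lemma L1_loc_realD:
  fixes f :: "'a::euclidean_space \<Rightarrow> real"
  assumes "(\<lambda>x. ereal (f x)) \<in> L1_loc"
  shows "f \<in> borel_measurable lebesgue"
    and "(\<integral>\<^sup>+y\<in>ball c r. ennreal \<bar>f y\<bar> \<partial>lebesgue) < \<infinity>"
proof -
  have "(\<lambda>x. real_of_ereal (ereal (f x))) \<in> borel_measurable lebesgue"
    using assms unfolding L1_loc_def by (intro borel_measurable_real_of_ereal) blast
  then show "f \<in> borel_measurable lebesgue"
    by simp
  have "(\<integral>\<^sup>+y\<in>ball c r. ennreal \<bar>f y\<bar> \<partial>lebesgue) \<le> (\<integral>\<^sup>+y\<in>cball c r. e2ennreal \<bar>ereal (f y)\<bar> \<partial>lebesgue)"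
    by (intro nn_integral_mono) (auto simp: indicator_def)
  also have "\<dots> < \<infinity>"
    using assms compact_cball[of c r] by (simp add: L1_loc_def)
  finally show "(\<integral>\<^sup>+y\<in>ball c r. ennreal \<bar>f y\<bar> \<partial>lebesgue) < \<infinity>" .
qed

text \<open>The term under the supremum in \<open>frac_maximal\<close>, isolated so that balls can
  be selected by the size of their mean.\<close>

definition frac_mean :: "real \<Rightarrow> ('a::euclidean_space \<Rightarrow> real) \<Rightarrow> 'a \<Rightarrow> real \<Rightarrow> ennreal" where
  "frac_mean \<alpha> f c r = ennreal (measure lebesgue (ball c r) powr (- 1 + \<alpha> / DIM('a))) *
     (\<integral>\<^sup>+y\<in>ball c r. ennreal \<bar>f y\<bar> \<partial>lebesgue)"

lemma frac_maximal_eq: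
  "frac_maximal \<alpha> f x = (SUP (c, r)\<in>{(c, r). 0 < r \<and> x \<in> ball c r}. frac_mean \<alpha> f c r)"
  by (simp add: frac_maximal_def frac_mean_def)

lemma frac_mean_le_maximal:
  "0 < r \<Longrightarrow> x \<in> ball c r \<Longrightarrow> frac_mean \<alpha> f c r \<le> frac_maximal \<alpha> f x"
  unfolding frac_maximal_eq by (rule SUP_upper2[of "(c, r)"]) auto

lemma less_frac_maximal_iff:
  "s < frac_maximal \<alpha> f x \<longleftrightarrow> (\<exists>c r. 0 < r \<and> x \<in> ball c r \<and> s < frac_mean \<alpha> f c r)"
  unfolding frac_maximal_eq less_SUP_iff by auto

text \<open>The maximal function is uncentred, so a ball with large mean lies entirely in the
  superlevel set. Superlevel sets are therefore open, and have the form to which the covering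
  estimate applies.\<close>

lemma frac_maximal_superlevel:
  "{x. s < frac_maximal \<alpha> f x} = (\<Union>(c, r)\<in>{(c, r). 0 < r \<and> s < frac_mean \<alpha> f c r}. ball c r)"
  by (fastforce simp: less_frac_maximal_iff)

lemma borel_measurable_frac_maximal [measurable]:
  "frac_maximal \<alpha> f \<in> borel_measurable lebesgue"
proof -
  have "frac_maximal \<alpha> f \<in> borel_measurable borel"
    by (rule borel_measurableI_greater)
      (auto simp: frac_maximal_superlevel intro!: borel_open open_UN)
  then show ?thesis
    by (rule borel_measurable_subalgebra[rotated 2]) auto
qed

text \<open>Applied at a fixed point with \<open>a = b x\<close>, it turns \<open>b x\<close> times
  the maximal function of \<open>f\<close> into the maximal function of
  \<open>b x * f\<close>.\<close>

lemma frac_maximal_cmult: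
  fixes f :: "'a::euclidean_space \<Rightarrow> real"
  assumes [measurable]: "f \<in> borel_measurable lebesgue" and a: "0 \<le> a"
  shows "frac_maximal \<alpha> (\<lambda>y. a * f y) x = ennreal a * frac_maximal \<alpha> f x"
proof -
  have "frac_mean \<alpha> (\<lambda>y. a * f y) c r = ennreal a * frac_mean \<alpha> f c r" for c r
  proof -
    have "(\<integral>\<^sup>+y\<in>ball c r. ennreal \<bar>a * f y\<bar> \<partial>lebesgue)
        = ennreal a * (\<integral>\<^sup>+y\<in>ball c r. ennreal \<bar>f y\<bar> \<partial>lebesgue)"
      using a by (subst nn_integral_cmult[symmetric]) (auto simp: abs_mult ennreal_mult mult.assoc)
    then show ?thesis
      by (simp add: frac_mean_def mult.left_commute)
  qed
  then show ?thesis
    unfolding frac_maximal_eq by (simp add: SUP_mult_left_ennreal case_prod_unfold)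
qed

text \<open>The factor \<open>|B| powr (\<beta> / n)\<close> in the error merges with the weight of
  the mean and raises its order from \<open>\<alpha>\<close> to \<open>\<alpha> + \<beta>\<close>.
  Both directions of the commutator estimate are instances.\<close>

lemma frac_maximal_le_add:
  fixes f g h :: "'a::euclidean_space \<Rightarrow> real"
  assumes [measurable]: "g \<in> borel_measurable lebesgue" "h \<in> borel_measurable lebesgue"
    and L: "0 \<le> L"
    and le: "\<And>c r y. \<lbrakk>0 < r; x \<in> ball c r; y \<in> ball c r\<rbrakk> \<Longrightarrow>
      \<bar>f y\<bar> \<le> \<bar>g y\<bar> + L * measure lebesgue (ball c r) powr (\<beta> / DIM('a)) * \<bar>h y\<bar>"
  shows "frac_maximal \<alpha> f x \<le> frac_maximal \<alpha> g x + ennreal L * frac_maximal (\<alpha> + \<beta>) h x"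
proof -
  have "frac_mean \<alpha> f c r \<le> frac_maximal \<alpha> g x + ennreal L * frac_maximal (\<alpha> + \<beta>) h x"
    if r: "0 < r" "x \<in> ball c r" for c r
  proof -
    define V where "V = measure lebesgue (ball c r)"
    let ?d = "L * V powr (\<beta> / DIM('a))"
    have "(\<integral>\<^sup>+y\<in>ball c r. ennreal \<bar>f y\<bar> \<partial>lebesgue) \<le>
       (\<integral>\<^sup>+y. ennreal \<bar>g y\<bar> * indicator (ball c r) y + ennreal ?d * (ennreal \<bar>h y\<bar> * indicator (ball c r) y) \<partial>lebesgue)"
    proof (rule nn_integral_mono)
      fix y
      show "ennreal \<bar>f y\<bar> * indicator (ball c r) y
        \<le> ennreal \<bar>g y\<bar> * indicator (ball c r) y + ennreal ?d * (ennreal \<bar>h y\<bar> * indicator (ball c r) y)"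
      proof (cases "y \<in> ball c r")
        case True
        then have "ennreal \<bar>f y\<bar> \<le> ennreal (\<bar>g y\<bar> + ?d * \<bar>h y\<bar>)"
          unfolding V_def by (intro ennreal_leI le r)
        also have "\<dots> = ennreal \<bar>g y\<bar> + ennreal ?d * ennreal \<bar>h y\<bar>"
          using L by (simp add: ennreal_plus ennreal_mult)
        finally show ?thesis
          using True by simp
      qed simp
    qed
    also have "\<dots> = (\<integral>\<^sup>+y\<in>ball c r. ennreal \<bar>g y\<bar> \<partial>lebesgue)
        + ennreal ?d * (\<integral>\<^sup>+y\<in>ball c r. ennreal \<bar>h y\<bar> \<partial>lebesgue)"
      by (subst nn_integral_add) (auto simp: nn_integral_cmult)
    finally have "frac_mean \<alpha> f c r \<le> ennreal (V powr (- 1 + \<alpha> / DIM('a))) *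
        ((\<integral>\<^sup>+y\<in>ball c r. ennreal \<bar>g y\<bar> \<partial>lebesgue)
          + ennreal ?d * (\<integral>\<^sup>+y\<in>ball c r. ennreal \<bar>h y\<bar> \<partial>lebesgue))"
      unfolding frac_mean_def V_def by (intro mult_left_mono) auto
    also have "\<dots> = frac_mean \<alpha> g c r + ennreal L * frac_mean (\<alpha> + \<beta>) h c r"
    proof -
      have "V powr (- 1 + (\<alpha> + \<beta>) / DIM('a)) = V powr (- 1 + \<alpha> / DIM('a)) * V powr (\<beta> / DIM('a))"
        by (simp add: add_divide_distrib algebra_simps flip: powr_add)
      then show ?thesis
        unfolding frac_mean_def V_def[symmetric] using L
        by (simp add: distrib_left ennreal_mult mult_ac)
    qed
    also have "\<dots> \<le> frac_maximal \<alpha> g x + ennreal L * frac_maximal (\<alpha> + \<beta>) h x"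
      using r by (intro add_mono mult_left_mono frac_mean_le_maximal) auto
    finally show ?thesis .
  qed
  then show ?thesis
    unfolding frac_maximal_eq[of \<alpha> f] by (intro SUP_least) auto
qed

lemma lipschitz_space_ball:
  fixes b :: "'a::euclidean_space \<Rightarrow> real"
  assumes "b \<in> lipschitz_space \<beta>" and \<beta>: "0 < \<beta>"
  obtains L where "0 < L"
    "\<And>c r x y. \<lbrakk>0 < r; x \<in> ball c r; y \<in> ball c r\<rbrakk> \<Longrightarrow>
      \<bar>b x - b y\<bar> \<le> L * measure lebesgue (ball c r) powr (\<beta> / DIM('a))"
proof -
  obtain C where C: "\<And>x y. \<bar>b x - b y\<bar> \<le> C * norm (x - y) powr \<beta>"
    using assms by (auto simp: lipschitz_space_def)
  define v where "v = unit_ball_vol (real DIM('a))"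
  have v: "0 < v" by (simp add: v_def)
  \<comment> \<open>The \<open>2 powr \<beta>\<close> comes from the diameter \<open>2 * r\<close>,
    the denominator from expressing \<open>r\<close> through the measure of the ball;
    \<open>\<bar>C\<bar> + 1\<close> makes \<open>L\<close> positive whatever the sign of
    \<open>C\<close>.\<close>
  define L where "L = (\<bar>C\<bar> + 1) * 2 powr \<beta> / v powr (\<beta> / DIM('a))"
  show ?thesis
  proof
    show "0 < L"
      using v by (simp add: L_def)
    fix c :: 'a and r :: real and x y
    assume r: "0 < r" and xy: "x \<in> ball c r" "y \<in> ball c r"
    have "norm (x - y) \<le> 2 * r"
      using xy dist_triangle2[of x y c] by (simp add: dist_norm dist_commute norm_minus_commute)
    have "\<bar>b x - b y\<bar> \<le> C * norm (x - y) powr \<beta>"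
      by (rule C)
    also have "\<dots> \<le> (\<bar>C\<bar> + 1) * (2 * r) powr \<beta>"
      using \<open>norm (x - y) \<le> 2 * r\<close> \<beta> by (intro mult_mono powr_mono2) auto
    also have "\<dots> = L * (v powr (\<beta> / DIM('a)) * r powr \<beta>)"
      using v r by (simp add: L_def powr_mult)
    also have "v powr (\<beta> / DIM('a)) * r powr \<beta> = measure lebesgue (ball c r) powr (\<beta> / DIM('a))"
      unfolding measure_lebesgue_ball[OF r] v_def[symmetric]
      using r v by (simp add: powr_mult powr_powr flip: powr_realpow)
    finally show "\<bar>b x - b y\<bar> \<le> L * measure lebesgue (ball c r) powr (\<beta> / DIM('a))" .
  qed
qed

text \<open>On a ball containing \<open>x\<close>, the functions \<open>b x * f\<close> and
  \<open>b * f\<close> differ by at most \<open>L * |B| powr (\<beta> / n) * \<bar>f\<bar>\<close>.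
  Hence each of the two maximal functions is bounded by the other plus the error. Finiteness at
  \<open>x\<close> excludes the difference of two infinities.\<close>

lemma max_commutator_bound:
  fixes b f :: "'a::euclidean_space \<Rightarrow> real"
  assumes b [measurable]: "b \<in> borel_measurable lebesgue" and f [measurable]: "f \<in> borel_measurable lebesgue"
    and b0: "\<And>x. 0 \<le> b x" and L: "0 < L"
    and lip: "\<And>c r x y. \<lbrakk>0 < r; x \<in> ball c r; y \<in> ball c r\<rbrakk> \<Longrightarrow>
      \<bar>b x - b y\<bar> \<le> L * measure lebesgue (ball c r) powr (\<beta> / DIM('a))"
    and fin: "frac_maximal \<alpha> f x < \<infinity>"
  shows "e2ennreal \<bar>max_commutator \<alpha> b f x\<bar> \<le> ennreal L * frac_maximal (\<alpha> + \<beta>) f x"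
proof (cases "frac_maximal (\<alpha> + \<beta>) f x = \<infinity>")
  case True
  then show ?thesis
    using L by (simp add: ennreal_mult_top)
next
  case False
  let ?P = "frac_maximal \<alpha> (\<lambda>y. b x * f y) x" and ?Q = "frac_maximal \<alpha> (\<lambda>y. b y * f y) x"
    and ?R = "ennreal L * frac_maximal (\<alpha> + \<beta>) f x"
  have P: "?P = ennreal (b x) * frac_maximal \<alpha> f x"
    by (intro frac_maximal_cmult b0 f)
  have le1: "?P \<le> ?Q + ?R"
  proof (rule frac_maximal_le_add)
    fix c r y assume *: "0 < r" "x \<in> ball c r" "y \<in> ball c r"
    have "\<bar>b x * f y\<bar> \<le> \<bar>b y * f y\<bar> + \<bar>b x - b y\<bar> * \<bar>f y\<bar>"
      unfolding abs_mult distrib_right[symmetric] by (intro mult_right_mono) auto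
    also have "\<dots> \<le> \<bar>b y * f y\<bar> + L * measure lebesgue (ball c r) powr (\<beta> / DIM('a)) * \<bar>f y\<bar>"
      by (intro add_left_mono mult_right_mono lip *) auto
    finally show "\<bar>b x * f y\<bar> \<le> \<bar>b y * f y\<bar> + L * measure lebesgue (ball c r) powr (\<beta> / DIM('a)) * \<bar>f y\<bar>" .
  qed (use L in auto)
  have le2: "?Q \<le> ?P + ?R"
  proof (rule frac_maximal_le_add)
    fix c r y assume *: "0 < r" "x \<in> ball c r" "y \<in> ball c r"
    have "\<bar>b y * f y\<bar> \<le> \<bar>b x * f y\<bar> + \<bar>b x - b y\<bar> * \<bar>f y\<bar>"
      unfolding abs_mult distrib_right[symmetric] by (intro mult_right_mono) auto
    also have "\<dots> \<le> \<bar>b x * f y\<bar> + L * measure lebesgue (ball c r) powr (\<beta> / DIM('a)) * \<bar>f y\<bar>"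
      by (intro add_left_mono mult_right_mono lip *) auto
    finally show "\<bar>b y * f y\<bar> \<le> \<bar>b x * f y\<bar> + L * measure lebesgue (ball c r) powr (\<beta> / DIM('a)) * \<bar>f y\<bar>" .
  qed (use L in auto)
  obtain m where m: "frac_maximal \<alpha> f x = ennreal m" "0 \<le> m"
    using fin by (cases "frac_maximal \<alpha> f x") auto
  have R: "?R < \<infinity>"
    using False by (simp add: ennreal_mult_less_top less_top)
  then obtain u where u: "?R = ennreal u" "0 \<le> u"
    by (cases ?R) auto
  have P': "?P = ennreal (b x * m)"
    unfolding P m using m b0 by (simp add: ennreal_mult)
  \<comment> \<open>Both terms of the commutator are now finite, so its \<open>ereal\<close>
    subtraction is the real one.\<close>
  have "?Q < \<infinity>"
    using le2 unfolding P' u by (rule le_less_trans) simp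
  then obtain q where q: "?Q = ennreal q" "0 \<le> q"
    by (cases ?Q) auto
  have "b x * m \<le> q + u" "q \<le> b x * m + u"
    using le1 le2 m u q b0 unfolding P' u q by (auto simp flip: ennreal_plus)
  moreover have "max_commutator \<alpha> b f x = ereal (b x * m - q)"
    unfolding max_commutator_def q m using m q by simp
  ultimately show ?thesis
    unfolding u by (auto intro!: ennreal_leI)
qed

section \<open>Bounds for functions of modular at most one\<close>

context
  fixes \<Phi> \<Psi> :: "real \<Rightarrow> ennreal" and \<gamma> C l :: real and f :: "'a::euclidean_space \<Rightarrow> real"
  assumes \<Phi>: "\<Phi> \<in> young_class_Y"
    and \<gamma>: "0 \<le> \<gamma>" and C: "0 < C"
    and inverse_le: "\<And>t. 0 < t \<Longrightarrow>
      t powr (- (\<gamma> / DIM('a))) * young_inverse \<Phi> t \<le> C * young_inverse \<Psi> t"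
    and f: "(\<lambda>x. ereal (f x)) \<in> L1_loc"
    and l: "0 < l" and modular: "(\<integral>\<^sup>+x. \<Phi> (\<bar>f x\<bar> / l) \<partial>lebesgue) \<le> 1"
begin

lemma modular_measurable: "(\<lambda>x. \<Phi> (\<bar>f x\<bar> / l)) \<in> borel_measurable lebesgue"
  by (rule borel_measurable_young[OF \<Phi> L1_loc_realD(1)[OF f] l])

lemma modular_ball_le_1: "(\<integral>\<^sup>+y\<in>ball c r. \<Phi> (\<bar>f y\<bar> / l) \<partial>lebesgue) \<le> 1"
  using modular by (rule order_trans[rotated]) (auto intro!: nn_integral_mono simp: indicator_def)

text \<open>The inverse hypothesis is used at the mean of the modular density,
  \<open>\<tau> = a / V\<close>. The modular bound \<open>a \<le> 1\<close> gives
  \<open>\<tau> \<le> 1 / V\<close>, which converts the weight \<open>V powr e\<close> into the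
  required \<open>\<tau> powr (- e)\<close>.\<close>

lemma frac_mean_modular:
  assumes r: "0 < r" and t: "0 < t" and gt: "ennreal (2 * C * t * l) < frac_mean \<gamma> f c r"
  shows "\<Psi> t * emeasure lebesgue (ball c r) \<le> (\<integral>\<^sup>+y\<in>ball c r. \<Phi> (\<bar>f y\<bar> / l) \<partial>lebesgue)"
    (is "_ \<le> ?A")
proof -
  define V where "V = measure lebesgue (ball c r)"
  have V: "0 < V" "emeasure lebesgue (ball c r) = ennreal V"
    unfolding V_def using r by (rule measure_lebesgue_ball_pos emeasure_lebesgue_ball)+
  define e where "e = \<gamma> / DIM('a)"
  have e: "0 \<le> e" using \<gamma> by (simp add: e_def)
  obtain i where i: "(\<integral>\<^sup>+y\<in>ball c r. ennreal \<bar>f y\<bar> \<partial>lebesgue) = ennreal i" "0 \<le> i"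
    using L1_loc_realD(2)[OF f, of c r] by (cases "\<integral>\<^sup>+y\<in>ball c r. ennreal \<bar>f y\<bar> \<partial>lebesgue") auto
  obtain a where a: "?A = ennreal a" "0 \<le> a"
    using modular_ball_le_1[of c r] by (cases ?A) (auto simp: top_unique)
  have a1: "a \<le> 1"
    using modular_ball_le_1[of c r] unfolding a by simp
  have "frac_mean \<gamma> f c r = ennreal (V powr (- 1 + e) * i)"
    unfolding frac_mean_def i V_def[symmetric] e_def[symmetric] using i by (simp add: ennreal_mult)
  then have "2 * C * t * l < V powr (- 1 + e) * i"
    using gt C t l by (simp add: ennreal_less_iff)
  also have "\<dots> = V powr e * (i / V)"
    using V by (simp add: powr_diff)
  finally have *: "2 * C * t * l < V powr e * (i / V)" .
  \<comment> \<open>Half the mean of \<open>\<bar>f\<bar> / l\<close>, so that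
    \<open>2 * z * l * V\<close> is exactly the integral of \<open>\<bar>f\<bar>\<close> over the
    ball, as \<open>young_mean_bound\<close> demands.\<close>
  define z where "z = i / (2 * l * V)"
  have Ct: "C * t < V powr e * z"
    using * l V by (simp add: z_def field_simps)
  have "0 < V powr e * z"
    using Ct C t by (smt (verit) mult_pos_pos)
  then have z: "0 < z"
    by (simp add: zero_less_mult_iff)
  have le: "\<Phi> z * emeasure lebesgue (ball c r) \<le> ?A"
  proof (rule young_mean_bound[OF \<Phi> L1_loc_realD(1)[OF f] l z r])
    show "ennreal (2 * z * l) * emeasure lebesgue (ball c r)
        \<le> (\<integral>\<^sup>+y\<in>ball c r. ennreal \<bar>f y\<bar> \<partial>lebesgue)"
      unfolding V i using V l i by (simp add: z_def flip: ennreal_mult)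
  qed
  obtain p where p: "\<Phi> z = ennreal p" "0 < p"
    using young_class_Y_D(2,3)[OF \<Phi>, of z] z by (cases "\<Phi> z") auto
  have pV: "p * V \<le> a"
    using le p V a unfolding p V a by (simp flip: ennreal_mult)
  \<comment> \<open>Positivity of \<open>\<Phi> z\<close> makes \<open>\<tau>\<close> positive, and
    the inverse hypothesis covers only positive arguments.\<close>
  then have a0: "0 < a"
    using p V by (smt (verit) mult_pos_pos)
  define \<tau> where "\<tau> = a / V"
  have \<tau>: "0 < \<tau>" using a0 V by (simp add: \<tau>_def)
  have "p \<le> \<tau>"
    using pV V by (simp add: \<tau>_def field_simps)
  then have zle: "z \<le> young_inverse \<Phi> \<tau>"
    using z p by (intro le_young_inverse young_class_Y_D[OF \<Phi>]) (auto intro: ennreal_leI)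
  have "V powr e = (1 / V) powr (- e)"
    using V by (simp add: powr_minus powr_divide)
  also have "\<dots> \<le> \<tau> powr (- e)"
    using e \<tau> V a1 by (intro powr_mono2') (auto simp: \<tau>_def divide_right_mono)
  finally have Ve: "V powr e \<le> \<tau> powr (- e)" .
  have "C * t < V powr e * z"
    by (rule Ct)
  also have "\<dots> \<le> \<tau> powr (- e) * young_inverse \<Phi> \<tau>"
    using Ve zle z by (intro mult_mono) auto
  also have "\<dots> \<le> C * young_inverse \<Psi> \<tau>"
    using inverse_le[OF \<tau>] by (simp add: e_def)
  finally have "t < young_inverse \<Psi> \<tau>"
    using C by simp
  then have "\<Psi> t \<le> ennreal \<tau>"
    using t by (intro less_young_inverseD) auto
  then have "\<Psi> t * emeasure lebesgue (ball c r) \<le> ennreal \<tau> * emeasure lebesgue (ball c r)"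
    by (rule mult_right_mono) simp
  also have "\<dots> = ?A"
    unfolding V a using V a by (simp add: \<tau>_def flip: ennreal_mult)
  finally show ?thesis .
qed

text \<open>The covering argument is run at the larger level \<open>T = 5 ^ n * t\<close>; convexity
  gives \<open>\<Psi> t \<le> \<Psi> T / 5 ^ n\<close>, which cancels the Vitali constant.\<close>

lemma frac_maximal_weak_bound:
  assumes \<Psi>: "young_function \<Psi>" and t: "0 < t"
  shows "\<Psi> t * emeasure lebesgue {x. ennreal (2 * C * (5 ^ DIM('a) * t) * l) < frac_maximal \<gamma> f x} \<le> 1"
proof -
  define T where "T = 5 ^ DIM('a) * t"
  have T: "0 < T" using t by (simp add: T_def)
  define W where "W = {(c, r). 0 < r \<and> ennreal (2 * C * T * l) < frac_mean \<gamma> f c r}"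
  define E where "E = (\<Union>(c, r)\<in>W. ball c r)"
  have W: "0 < r" "\<Psi> T * emeasure lebesgue (ball c r) \<le> (\<integral>\<^sup>+y\<in>ball c r. \<Phi> (\<bar>f y\<bar> / l) \<partial>lebesgue)"
    if "(c, r) \<in> W" for c r
    using that frac_mean_modular[OF _ T, of r c] by (auto simp: W_def)
  have "\<Psi> (1 / 5 ^ DIM('a) * T) \<le> ennreal (1 / 5 ^ DIM('a)) * \<Psi> T"
    using T by (intro young_function_scale[OF \<Psi>]) auto
  then have \<Psi>t: "\<Psi> t \<le> ennreal (1 / 5 ^ DIM('a)) * \<Psi> T"
    by (simp add: T_def)
  have "\<Psi> t * emeasure lebesgue E \<le> 1"
  proof (cases "\<Psi> T")
    case (real k)
    show ?thesis
    proof (cases "k = 0")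
      case True
      then show ?thesis using real \<Psi>t by simp
    next
      case False
      then have k: "0 < k" using real by simp
      have "ennreal k * emeasure lebesgue E \<le> 5 ^ DIM('a) * (\<integral>\<^sup>+x. \<Phi> (\<bar>f x\<bar> / l) \<partial>lebesgue)"
        unfolding E_def
      proof (rule vitali_weak_bound[OF modular_measurable _ k])
        show "(\<integral>\<^sup>+x. \<Phi> (\<bar>f x\<bar> / l) \<partial>lebesgue) < \<infinity>"
          using modular by (rule le_less_trans) simp
      qed (use W real in auto)
      also have "\<dots> \<le> 5 ^ DIM('a) * 1"
        by (intro mult_left_mono modular) auto
      finally have kE: "ennreal k * emeasure lebesgue E \<le> 5 ^ DIM('a)"
        by simp
      have "\<Psi> t * emeasure lebesgue E \<le> ennreal (1 / 5 ^ DIM('a)) * \<Psi> T * emeasure lebesgue E"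
        by (intro mult_right_mono \<Psi>t) auto
      also have "\<dots> = ennreal (1 / 5 ^ DIM('a)) * (ennreal k * emeasure lebesgue E)"
        by (simp add: real mult.assoc)
      also have "\<dots> \<le> ennreal (1 / 5 ^ DIM('a)) * ennreal (5 ^ DIM('a))"
        using kE by (intro mult_left_mono) (auto simp flip: ennreal_power)
      also have "\<dots> = 1"
        by (simp flip: ennreal_mult)
      finally show ?thesis .
    qed
  next
    case top
    \<comment> \<open>With \<open>\<Psi> T\<close> infinite, a ball of positive measure in
      \<open>W\<close> would have infinite modular.\<close>
    have "W = {}"
    proof (rule ccontr)
      assume "W \<noteq> {}"
      then obtain c r where cr: "(c, r) \<in> W" by auto
      have "\<Psi> T * emeasure lebesgue (ball c r) \<le> 1"
        using W(2)[OF cr] modular_ball_le_1 by (rule order_trans)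
      then show False
        using top measure_lebesgue_ball_pos[OF W(1)[OF cr], of c]
        unfolding emeasure_lebesgue_ball[OF W(1)[OF cr]]
        by (simp add: ennreal_top_mult top_unique)
    qed
    then show ?thesis by (simp add: E_def)
  qed
  then show ?thesis
    unfolding E_def W_def T_def frac_maximal_superlevel .
qed

text \<open>Take \<open>t\<close> with \<open>\<Psi> t > 1\<close>: a mean above
  \<open>2 * C * t * l\<close> forces \<open>\<Psi> t * |B| \<le> 1\<close>, impossible once
  \<open>|B|\<close> is at least one. Above the level \<open>K\<close> only balls of measure less
  than one matter.\<close>

lemma frac_mean_large_ball:
  assumes \<Psi>: "young_function \<Psi>"
  obtains K where
    "\<And>c r. \<lbrakk>0 < r; 1 \<le> measure lebesgue (ball c r)\<rbrakk> \<Longrightarrow> frac_mean \<gamma> f c r \<le> ennreal K"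
proof -
  obtain t where t: "0 < t" "ennreal 1 < \<Psi> t"
    by (rule young_function_exists_gt[OF \<Psi>])
  show ?thesis
  proof
    fix c :: 'a and r :: real
    assume r: "0 < r" and V: "1 \<le> measure lebesgue (ball c r)"
    show "frac_mean \<gamma> f c r \<le> ennreal (2 * C * t * l)"
    proof (rule ccontr)
      assume "\<not> frac_mean \<gamma> f c r \<le> ennreal (2 * C * t * l)"
      then have "\<Psi> t * emeasure lebesgue (ball c r) \<le> 1"
        using frac_mean_modular[OF r t(1), of c] modular_ball_le_1[of c r] by (simp add: not_le)
      moreover have "\<Psi> t * 1 \<le> \<Psi> t * emeasure lebesgue (ball c r)"
        unfolding emeasure_lebesgue_ball[OF r] using V by (intro mult_left_mono) auto
      ultimately show False
        using t by simp
    qed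
  qed
qed

text \<open>At high levels only balls with \<open>|B| < 1\<close> contribute. There the weight
  \<open>|B| powr (\<alpha> / n)\<close> is at most one, so the plain mean of
  \<open>\<bar>f\<bar>\<close> is large and \<open>young_mean_bound\<close> applies. Since
  \<open>\<Phi>\<close> is unbounded, the resulting bound on the set \<open>N\<close> of infinite
  values holds with every factor \<open>a\<close>.\<close>

lemma frac_maximal_finite_AE:
  assumes \<Psi>: "young_function \<Psi>" and \<alpha>: "0 \<le> \<alpha>" "\<alpha> \<le> \<gamma>"
  shows "AE x in lebesgue. frac_maximal \<alpha> f x < \<infinity>"
proof -
  obtain K where K:
    "\<And>c r. \<lbrakk>0 < r; 1 \<le> measure lebesgue (ball c r)\<rbrakk> \<Longrightarrow> frac_mean \<gamma> f c r \<le> ennreal K"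
    using frac_mean_large_ball[OF \<Psi>] by blast
  define N where "N = {x. frac_maximal \<alpha> f x = \<infinity>}"
  have bound: "ennreal a * emeasure lebesgue N \<le> 5 ^ DIM('a)" if a: "0 < a" for a
  proof -
    obtain s\<^sub>0 where s0: "0 < s\<^sub>0" "ennreal a < \<Phi> s\<^sub>0"
      by (rule young_function_exists_gt[OF young_class_Y_D(1)[OF \<Phi>]])
    \<comment> \<open>The first entry ensures \<open>\<Phi> s \<ge> a\<close>, the second that the
      level \<open>2 * s * l\<close> is at least \<open>K\<close>, which rules out large
      balls.\<close>
    define s where "s = max s\<^sub>0 (K / (2 * l))"
    have s: "0 < s" "ennreal a \<le> \<Phi> s" "K \<le> 2 * s * l"
    proof -
      show "0 < s" using s0 by (simp add: s_def)
      have "\<Phi> s\<^sub>0 \<le> \<Phi> s"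
        using s0 by (intro young_function_mono young_class_Y_D(1)[OF \<Phi>]) (auto simp: s_def)
      then show "ennreal a \<le> \<Phi> s" using s0 by simp
      have "K / (2 * l) \<le> s" by (simp add: s_def)
      then show "K \<le> 2 * s * l" using l by (simp add: field_simps)
    qed
    define W where "W = {(c, r). 0 < r \<and> ennreal (2 * s * l) < frac_mean \<alpha> f c r}"
    have le: "ennreal a * emeasure lebesgue (ball c r) \<le> (\<integral>\<^sup>+y\<in>ball c r. \<Phi> (\<bar>f y\<bar> / l) \<partial>lebesgue)"
      if "(c, r) \<in> W" for c r
    proof -
      have r: "0 < r" and gt: "ennreal (2 * s * l) < frac_mean \<alpha> f c r"
        using that by (auto simp: W_def)
      define V where "V = measure lebesgue (ball c r)"
      have V: "0 < V" "emeasure lebesgue (ball c r) = ennreal V"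
        unfolding V_def using r by (rule measure_lebesgue_ball_pos emeasure_lebesgue_ball)+
      let ?I = "\<integral>\<^sup>+y\<in>ball c r. ennreal \<bar>f y\<bar> \<partial>lebesgue"
      have "V < 1"
      proof (rule ccontr)
        assume "\<not> V < 1"
        then have V1: "1 \<le> V" by simp
        have "frac_mean \<alpha> f c r \<le> frac_mean \<gamma> f c r"
          unfolding frac_mean_def V_def[symmetric] using V1 \<alpha>
          by (intro mult_right_mono ennreal_leI powr_mono) (auto simp: divide_right_mono)
        also have "\<dots> \<le> ennreal K"
          using K r V1 by (simp add: V_def)
        also have "\<dots> \<le> ennreal (2 * s * l)"
          using s by (intro ennreal_leI)
        finally show False using gt by simp
      qed
      have "ennreal (2 * s * l) * ennreal V \<le> frac_mean \<alpha> f c r * ennreal V"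
        using gt by (intro mult_right_mono) auto
      also have "\<dots> = ennreal (V powr (- 1 + \<alpha> / DIM('a)) * V) * ?I"
        unfolding frac_mean_def V_def[symmetric] using V by (simp add: ennreal_mult mult_ac)
      also have "V powr (- 1 + \<alpha> / DIM('a)) * V = V powr (\<alpha> / DIM('a))"
        using V by (simp add: powr_diff)
      also have "ennreal (V powr (\<alpha> / DIM('a))) * ?I \<le> 1 * ?I"
        using V \<open>V < 1\<close> \<alpha> by (intro mult_right_mono) (auto simp: ennreal_le_1 powr_le1)
      finally have "\<Phi> s * emeasure lebesgue (ball c r) \<le> (\<integral>\<^sup>+y\<in>ball c r. \<Phi> (\<bar>f y\<bar> / l) \<partial>lebesgue)"
        unfolding V(2)[symmetric] by (intro young_mean_bound[OF \<Phi> L1_loc_realD(1)[OF f] l s(1) r]) simp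
      moreover have "ennreal a * emeasure lebesgue (ball c r) \<le> \<Phi> s * emeasure lebesgue (ball c r)"
        using s by (intro mult_right_mono) auto
      ultimately show ?thesis by simp
    qed
    have "N \<subseteq> {x. ennreal (2 * s * l) < frac_maximal \<alpha> f x}"
      by (auto simp: N_def)
    then have "emeasure lebesgue N \<le> emeasure lebesgue {x. ennreal (2 * s * l) < frac_maximal \<alpha> f x}"
      unfolding frac_maximal_superlevel
      by (intro emeasure_mono) (auto intro!: open_sets_lebesgue open_UN)
    then have "ennreal a * emeasure lebesgue N \<le> ennreal a * emeasure lebesgue (\<Union>(c, r)\<in>W. ball c r)"
      unfolding W_def frac_maximal_superlevel by (rule mult_left_mono) simp
    also have "\<dots> \<le> 5 ^ DIM('a) * (\<integral>\<^sup>+x. \<Phi> (\<bar>f x\<bar> / l) \<partial>lebesgue)"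
    proof (rule vitali_weak_bound[OF modular_measurable _ a _ le])
      show "(\<integral>\<^sup>+x. \<Phi> (\<bar>f x\<bar> / l) \<partial>lebesgue) < \<infinity>"
        using modular by (rule le_less_trans) simp
    qed (auto simp: W_def)
    also have "\<dots> \<le> 5 ^ DIM('a) * 1"
      by (intro mult_left_mono modular) auto
    finally show ?thesis by simp
  qed
  have "emeasure lebesgue N = 0"
  proof (cases "emeasure lebesgue N")
    case (real e)
    show ?thesis
    proof (rule ccontr)
      assume "emeasure lebesgue N \<noteq> 0"
      then have e: "0 < e" using real by (cases "e = 0") auto
      \<comment> \<open>For this \<open>a\<close> the bound would read
        \<open>5 ^ n + 1 \<le> 5 ^ n\<close>.\<close>
      define a where "a = (5 ^ DIM('a) + 1) / e"
      have a: "0 < a" using e by (simp add: a_def add_pos_pos)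
      have "ennreal (a * e) \<le> ennreal (5 ^ DIM('a))"
        using bound[OF a] a real by (simp add: ennreal_mult flip: ennreal_power)
      then have "a * e \<le> 5 ^ DIM('a)"
        by (subst (asm) ennreal_le_iff) auto
      then show False using e by (simp add: a_def)
    qed
  next
    case top
    then show ?thesis
      using bound[of 1] by (simp add: top_unique power_eq_top_ennreal)
  qed
  moreover have "N \<in> sets lebesgue"
    using measurable_sets[OF borel_measurable_frac_maximal, of "{\<infinity>}" \<alpha> f]
    by (simp add: N_def vimage_def)
  ultimately have "AE x in lebesgue. x \<notin> N"
    by (intro AE_not_in) (auto simp: null_sets_def)
  then show ?thesis
    by eventually_elim (auto simp: N_def less_top)
qed

end

section \<open>Local integrability of the fractional maximal function\<close>

text \<open>The sum counts the natural numbers below \<open>h\<close>, starting with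
  \<open>0\<close>, and so equals \<open>h\<close> rounded up. Integrated, this is a discrete layer
  cake formula.\<close>

lemma ennreal_le_suminf_indicator:
  fixes h :: ennreal
  shows "h \<le> (\<Sum>k. indicator {k. of_nat k < h} k)"
proof -
  have N: "of_nat N \<le> (\<Sum>k. indicator {k. of_nat k < h} k :: ennreal)"
    if "\<And>k. k < N \<Longrightarrow> of_nat k < h" for N
  proof -
    have "(of_nat N :: ennreal) = (\<Sum>k<N. indicator {k. of_nat k < h} k)"
      using that by simp
    also have "\<dots> \<le> (\<Sum>k. indicator {k. of_nat k < h} k)"
      by (intro sum_le_suminf) auto
    finally show ?thesis .
  qed
  show ?thesis
  proof (cases h)
    case (real x)
    have "h \<le> of_nat (nat \<lceil>x\<rceil>)"
      unfolding real ennreal_of_nat_eq_real_of_nat by (intro ennreal_leI) linarith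
    also have "\<dots> \<le> (\<Sum>k. indicator {k. of_nat k < h} k)"
    proof (rule N)
      fix k assume "k < nat \<lceil>x\<rceil>"
      then have "real k < x" by linarith
      then show "of_nat k < h"
        unfolding real ennreal_of_nat_eq_real_of_nat by (simp add: ennreal_less_iff)
    qed
    finally show ?thesis .
  next
    case top
    have "(SUP N. of_nat N :: ennreal) \<le> (\<Sum>k. indicator {k. of_nat k < h} k)"
      by (intro SUP_least N) (simp add: top of_nat_less_top)
    then show ?thesis
      by (simp add: top ennreal_SUP_of_nat_eq_top top_unique)
  qed
qed

text \<open>On \<open>S\<close> the superlevel sets at high levels have measure of order
  \<open>s powr (- p)\<close> with \<open>p = n / (n - \<gamma>)\<close>. Since
  \<open>\<gamma> > 0\<close> gives \<open>p > 1\<close>, these measures are summable over integer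
  levels.\<close>

lemma frac_maximal_locally_integrable:
  fixes f :: "'a::euclidean_space \<Rightarrow> real" and \<gamma> :: real
  assumes f: "(\<lambda>x. ereal (f x)) \<in> L1_loc"
    and \<gamma>: "0 < \<gamma>" "\<gamma> < DIM('a)"
    and large: "\<And>c r. \<lbrakk>0 < r; 1 \<le> measure lebesgue (ball c r)\<rbrakk> \<Longrightarrow> frac_mean \<gamma> f c r \<le> ennreal K"
    and S: "compact S"
  shows "(\<integral>\<^sup>+x\<in>S. frac_maximal \<gamma> f x \<partial>lebesgue) < \<infinity>"
proof -
  have [measurable]: "f \<in> borel_measurable lebesgue"
    by (rule L1_loc_realD(1)[OF f])
  have [measurable]: "S \<in> sets lebesgue"
    using S by (intro lmeasurable_compact fmeasurableD)
  define v where "v = unit_ball_vol (real DIM('a))"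
  have v: "0 < v" by (simp add: v_def)
  define \<rho> where "\<rho> = max 1 (1 / v)"
  have rad: "r \<le> \<rho>" if r: "0 < r" "measure lebesgue (ball c r) < 1" for c :: 'a and r
  proof -
    have "r ^ DIM('a) < 1 / v"
      using r v unfolding measure_lebesgue_ball[OF r(1)] v_def[symmetric] by (simp add: field_simps)
    moreover have "r \<le> r ^ DIM('a)" if "1 \<le> r"
      using that by (simp add: self_le_power)
    ultimately show ?thesis
      unfolding \<rho>_def by linarith
  qed
  obtain R where R: "\<And>x. x \<in> S \<Longrightarrow> norm x < R"
    using compact_imp_bounded[OF S] by (auto simp: bounded_pos_less)
  \<comment> \<open>\<open>U\<close> contains every ball of measure less than one that meets
    \<open>S\<close>, since such a ball has radius at most \<open>\<rho>\<close>.\<close>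
  define U where "U = ball (0::'a) (R + 2 * \<rho>)"
  have [measurable]: "U \<in> sets lebesgue" by (simp add: U_def)
  define G where "G = enn2real (\<integral>\<^sup>+y\<in>U. ennreal \<bar>f y\<bar> \<partial>lebesgue)"
  have G: "(\<integral>\<^sup>+y\<in>U. ennreal \<bar>f y\<bar> \<partial>lebesgue) = ennreal G" "0 \<le> G"
    using L1_loc_realD(2)[OF f] by (auto simp: G_def U_def)
  define e where "e = 1 - \<gamma> / DIM('a)"
  have e: "0 < e" "e < 1" using \<gamma> by (auto simp: e_def)
  define p where "p = 1 / e"
  have p: "1 < p" using e by (simp add: p_def)
  \<comment> \<open>For balls inside \<open>U\<close>, the \<open>p\<close>-th power of the integral
    of \<open>\<bar>f\<bar>\<close> is at most the integral of \<open>g\<close>. This makes the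
    power estimate additive over disjoint balls.\<close>
  define g where "g y = ennreal (G powr (p - 1)) * (ennreal \<bar>f y\<bar> * indicator U y)" for y
  have g: "(\<integral>\<^sup>+y. g y \<partial>lebesgue) = ennreal (G powr (p - 1) * G)"
    unfolding g_def using G by (simp add: nn_integral_cmult ennreal_mult)
  define A where "A = 5 ^ DIM('a) * (G powr (p - 1) * G)"
  have A: "0 \<le> A" using G by (simp add: A_def)

  have level: "emeasure lebesgue ({x. ennreal s < frac_maximal \<gamma> f x} \<inter> S) \<le> ennreal (A * s powr (- p))"
    if s: "0 < s" "K \<le> s" for s
  proof -
    define W where "W = {(c, r). 0 < r \<and> ball c r \<subseteq> U \<and> ennreal s < frac_mean \<gamma> f c r
      \<and> measure lebesgue (ball c r) < 1}"
    have sub: "{x. ennreal s < frac_maximal \<gamma> f x} \<inter> S \<subseteq> (\<Union>(c, r)\<in>W. ball c r)"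
    proof
      fix x assume "x \<in> {x. ennreal s < frac_maximal \<gamma> f x} \<inter> S"
      then obtain c r where x: "x \<in> S" and cr: "0 < r" "x \<in> ball c r" "ennreal s < frac_mean \<gamma> f c r"
        by (auto simp: less_frac_maximal_iff)
      have small: "measure lebesgue (ball c r) < 1"
      proof (rule ccontr)
        assume "\<not> measure lebesgue (ball c r) < 1"
        then have "frac_mean \<gamma> f c r \<le> ennreal K"
          using cr by (intro large) auto
        also have "\<dots> \<le> ennreal s"
          using s by (intro ennreal_leI)
        finally show False using cr by simp
      qed
      have "ball c r \<subseteq> U"
      proof
        fix y assume "y \<in> ball c r"
        then have "dist x y < 2 * r"
          using cr(2) dist_triangle3[of x y c] by (simp add: dist_commute)
        moreover have "norm y \<le> norm x + dist x y"
          using dist_triangle[of 0 y x] by simp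
        ultimately show "y \<in> U"
          using R[OF x] rad[OF cr(1) small] by (simp add: U_def)
      qed
      then show "x \<in> (\<Union>(c, r)\<in>W. ball c r)"
        using cr small by (auto simp: W_def)
    qed
    have "ennreal (s powr p) * emeasure lebesgue (\<Union>(c, r)\<in>W. ball c r)
        \<le> 5 ^ DIM('a) * (\<integral>\<^sup>+y. g y \<partial>lebesgue)"
    proof (rule vitali_weak_bound)
      show "g \<in> borel_measurable lebesgue"
        unfolding g_def by measurable
      show "(\<integral>\<^sup>+y. g y \<partial>lebesgue) < \<infinity>"
        by (simp add: g)
      show "0 < s powr p"
        using s by simp
      show "0 < r" if "(c, r) \<in> W" for c r
        using that by (auto simp: W_def)
      show "ennreal (s powr p) * emeasure lebesgue (ball c r) \<le> (\<integral>\<^sup>+y\<in>ball c r. g y \<partial>lebesgue)"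
        if "(c, r) \<in> W" for c r
      proof -
        have r: "0 < r" and BU: "ball c r \<subseteq> U" and gt: "ennreal s < frac_mean \<gamma> f c r"
          using that by (auto simp: W_def)
        define V where "V = measure lebesgue (ball c r)"
        have V: "0 < V" "emeasure lebesgue (ball c r) = ennreal V"
          unfolding V_def using r by (rule measure_lebesgue_ball_pos emeasure_lebesgue_ball)+
        obtain i where i: "(\<integral>\<^sup>+y\<in>ball c r. ennreal \<bar>f y\<bar> \<partial>lebesgue) = ennreal i" "0 \<le> i"
          using L1_loc_realD(2)[OF f, of c r]
          by (cases "\<integral>\<^sup>+y\<in>ball c r. ennreal \<bar>f y\<bar> \<partial>lebesgue") auto
        have "ennreal i \<le> ennreal G"
          unfolding i(1)[symmetric] G(1)[symmetric]
          using BU by (intro nn_integral_mono) (auto simp: indicator_def)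
        then have iG: "i \<le> G" using G by simp
        have "frac_mean \<gamma> f c r = ennreal (V powr (- e) * i)"
          unfolding frac_mean_def i V_def[symmetric] using i by (simp add: ennreal_mult e_def)
        then have "s < V powr (- e) * i"
          using gt s by (simp add: ennreal_less_iff)
        then have *: "s * V powr e < i"
          using V by (simp add: powr_minus field_simps)
        have i0: "0 < i"
          using * s V by (smt (verit) mult_nonneg_nonneg powr_ge_zero)
        \<comment> \<open>Here \<open>e * p = 1\<close>, so raising \<open>s * V powr e < i\<close>
          to the power \<open>p\<close> produces exactly the measure \<open>V\<close>.\<close>
        have "s powr p * V = (s * V powr e) powr p"
          using s V e by (simp add: powr_mult powr_powr p_def)
        also have "\<dots> \<le> i powr p"
          using * s p by (intro powr_mono2) auto
        also have "\<dots> = i powr (p - 1) * i"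
          using i0 by (simp add: powr_diff)
        also have "\<dots> \<le> G powr (p - 1) * i"
          using i0 iG p by (intro mult_right_mono powr_mono2) auto
        finally have le: "s powr p * V \<le> G powr (p - 1) * i" .
        have "(\<integral>\<^sup>+y\<in>ball c r. g y \<partial>lebesgue)
            = (\<integral>\<^sup>+y. ennreal (G powr (p - 1)) * (ennreal \<bar>f y\<bar> * indicator (ball c r) y) \<partial>lebesgue)"
          unfolding g_def using BU by (intro nn_integral_cong) (auto simp: indicator_def)
        also have "\<dots> = ennreal (G powr (p - 1)) * ennreal i"
          unfolding i(1)[symmetric] by (rule nn_integral_cmult) auto
        also have "\<dots> = ennreal (G powr (p - 1) * i)"
          using i by (simp add: ennreal_mult)
        finally show ?thesis
          unfolding V using le V by (simp add: ennreal_leI flip: ennreal_mult)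
      qed
    qed
    also have "\<dots> = ennreal A"
      unfolding g A_def using G by (simp add: ennreal_mult flip: ennreal_power)
    finally have sW: "ennreal (s powr p) * emeasure lebesgue (\<Union>(c, r)\<in>W. ball c r) \<le> ennreal A" .
    have "emeasure lebesgue ({x. ennreal s < frac_maximal \<gamma> f x} \<inter> S)
        \<le> emeasure lebesgue (\<Union>(c, r)\<in>W. ball c r)"
      using sub by (intro emeasure_mono) (auto intro!: open_sets_lebesgue open_UN)
    also have "\<dots> = ennreal (s powr (- p)) * (ennreal (s powr p) * emeasure lebesgue (\<Union>(c, r)\<in>W. ball c r))"
      using s by (simp add: mult.assoc[symmetric] ennreal_mult[symmetric] powr_add[symmetric])
    also have "\<dots> \<le> ennreal (s powr (- p)) * ennreal A"
      by (intro mult_left_mono sW) auto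
    also have "\<dots> = ennreal (A * s powr (- p))"
      using A by (simp add: mult.commute flip: ennreal_mult)
    finally show ?thesis .
  qed

  \<comment> \<open>The level estimate requires \<open>s > 0\<close> and \<open>s \<ge> K\<close>;
    the finitely many smaller integers get the trivial bound by the measure of \<open>S\<close>,
    which does not affect summability.\<close>
  define a where "a k = (if real k < max K 1 then measure lebesgue S else A * real k powr (- p))" for k :: nat
  have fin_S: "emeasure lebesgue S = ennreal (measure lebesgue S)"
    using S by (intro emeasure_eq_measure2 lmeasurable_compact)
  have a: "emeasure lebesgue ({x. of_nat k < frac_maximal \<gamma> f x} \<inter> S) \<le> ennreal (a k)" for k
  proof (cases "real k < max K 1")
    case True
    have "emeasure lebesgue ({x. of_nat k < frac_maximal \<gamma> f x} \<inter> S) \<le> emeasure lebesgue S"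
      by (intro emeasure_mono) auto
    then show ?thesis
      unfolding fin_S using True by (simp add: a_def)
  next
    case False
    then show ?thesis
      using level[of "real k"] by (simp add: a_def ennreal_of_nat_eq_real_of_nat)
  qed
  have a0: "0 \<le> a k" for k
    using A by (simp add: a_def)
  have "summable (\<lambda>k. A * real k powr (- p))"
    using p by (intro summable_mult) (simp add: summable_real_powr_iff)
  moreover have "\<forall>\<^sub>F k in sequentially. a k = A * real k powr (- p)"
    using eventually_ge_at_top[of "nat \<lceil>max K 1\<rceil>"]
  proof eventually_elim
    case (elim k)
    then have "\<not> real k < max K 1" by linarith
    then show ?case by (simp add: a_def)
  qed
  ultimately have "summable a"
    by (subst summable_cong)
  have lev [measurable]: "{x. of_nat k < frac_maximal \<gamma> f x} \<in> sets lebesgue" for k :: nat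
    unfolding frac_maximal_superlevel by (auto intro!: open_sets_lebesgue open_UN)
  have "(\<integral>\<^sup>+x\<in>S. frac_maximal \<gamma> f x \<partial>lebesgue)
      \<le> (\<integral>\<^sup>+x. (\<Sum>k. indicator ({x. of_nat k < frac_maximal \<gamma> f x} \<inter> S) x) \<partial>lebesgue)"
  proof (rule nn_integral_mono)
    fix x
    show "frac_maximal \<gamma> f x * indicator S x
        \<le> (\<Sum>k. indicator ({x. of_nat k < frac_maximal \<gamma> f x} \<inter> S) x)"
      using ennreal_le_suminf_indicator[of "frac_maximal \<gamma> f x"]
      by (cases "x \<in> S") (simp_all add: indicator_def)
  qed
  also have "\<dots> = (\<Sum>k. emeasure lebesgue ({x. of_nat k < frac_maximal \<gamma> f x} \<inter> S))"
    by (subst nn_integral_suminf) (auto simp del: emeasure_completion)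
  also have "\<dots> \<le> (\<Sum>k. ennreal (a k))"
    by (intro suminf_le a) auto
  also have "\<dots> = ennreal (suminf a)"
    using \<open>summable a\<close> a0 by (simp add: suminf_ennreal2)
  also have "\<dots> < \<infinity>"
    by simp
  finally show ?thesis .
qed

section \<open>Boundedness of the commutator\<close>

text \<open>Convexity shrinks a finite modular \<open>J\<close> below one after scaling the argument
  by \<open>1 / (J + 1)\<close>. Hence the set defining the Orlicz norm is nonempty.\<close>

lemma orlicz_space_modular_le_1:
  assumes \<Phi>: "\<Phi> \<in> young_class_Y" and f: "f \<in> orlicz_space \<Phi>"
  obtains l where "0 < l" "(\<integral>\<^sup>+x. \<Phi> (\<bar>f x\<bar> / l) \<partial>lebesgue) \<le> 1"
proof -
  obtain k where k: "0 < k" and fin: "(\<integral>\<^sup>+x. \<Phi> (k * \<bar>f x\<bar>) \<partial>lebesgue) < \<infinity>"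
    using f by (auto simp: orlicz_space_def)
  obtain J where J: "(\<integral>\<^sup>+x. \<Phi> (k * \<bar>f x\<bar>) \<partial>lebesgue) = ennreal J" "0 \<le> J"
    using fin by (cases "\<integral>\<^sup>+x. \<Phi> (k * \<bar>f x\<bar>) \<partial>lebesgue") auto
  have fm: "f \<in> borel_measurable lebesgue"
    using f by (intro L1_loc_realD(1)) (simp add: orlicz_space_def)
  have [measurable]: "(\<lambda>x. \<Phi> (k * \<bar>f x\<bar>)) \<in> borel_measurable lebesgue"
    using borel_measurable_young[OF \<Phi> fm, of "1 / k"] k by (simp add: mult.commute)
  define u where "u = 1 / (J + 1)"
  have u: "0 < u" "u \<le> 1" "u * J \<le> 1"
    using J by (auto simp: u_def field_simps)
  show ?thesis
  proof
    show "0 < 1 / (u * k)" using u k by simp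
    have "(\<integral>\<^sup>+x. \<Phi> (\<bar>f x\<bar> / (1 / (u * k))) \<partial>lebesgue)
        \<le> (\<integral>\<^sup>+x. ennreal u * \<Phi> (k * \<bar>f x\<bar>) \<partial>lebesgue)"
    proof (rule nn_integral_mono)
      fix x
      have "\<Phi> (u * (k * \<bar>f x\<bar>)) \<le> ennreal u * \<Phi> (k * \<bar>f x\<bar>)"
        using u k by (intro young_function_scale young_class_Y_D(1)[OF \<Phi>]) auto
      then show "\<Phi> (\<bar>f x\<bar> / (1 / (u * k))) \<le> ennreal u * \<Phi> (k * \<bar>f x\<bar>)"
        by (simp add: mult_ac)
    qed
    also have "\<dots> = ennreal (u * J)"
      using u J by (simp add: nn_integral_cmult ennreal_mult)
    also have "\<dots> \<le> 1"
      using u by (simp add: ennreal_le_1)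
    finally show "(\<integral>\<^sup>+x. \<Phi> (\<bar>f x\<bar> / (1 / (u * k))) \<partial>lebesgue) \<le> 1" .
  qed
qed

text \<open>Translates the \<open>ereal\<close> level sets of the weak norm into the
  \<open>ennreal\<close> ones of the maximal function, infinite values included.\<close>

lemma ereal_less_divide_abs_imp:
  assumes "0 < m" "0 \<le> t" "ereal t < \<bar>y\<bar> / ereal m"
  shows "ennreal (m * t) < e2ennreal \<bar>y\<bar>"
proof (cases y)
  case (real u)
  then have "m * t < \<bar>u\<bar>"
    using assms by (simp add: pos_less_divide_eq mult.commute)
  then show ?thesis
    using assms by (simp add: real ennreal_less_iff)
qed simp_all

theorem theorem4p19:
  fixes b :: "real ^ 'n \<Rightarrow> real" and \<alpha> \<beta> :: real and \<Phi> \<Psi> :: "real \<Rightarrow> ennreal"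
  assumes "\<And>x. 0 \<le> b x"
    and "(\<lambda>x. ereal (b x)) \<in> L1_loc"
    and "0 < \<beta>" and "\<beta> < 1"
    and "0 \<le> \<alpha>" and "\<alpha> < real CARD('n)"
    and "0 < \<alpha> + \<beta>" and "\<alpha> + \<beta> < real CARD('n)"
    and "b \<in> lipschitz_space \<beta>"
    and "young_function \<Phi>" and "young_function \<Psi>"
    and "\<Phi> \<in> young_class_Y"
    and "\<exists>C>0. \<forall>t>0. t powr (- ((\<alpha> + \<beta>) / real CARD('n))) * young_inverse \<Phi> t
                       \<le> C * young_inverse \<Psi> t"
  shows "bounded_operator (orlicz_space \<Phi>) (orlicz_norm \<Phi>)
           (weak_orlicz_space \<Psi>) (weak_orlicz_norm \<Psi>) (max_commutator \<alpha> b)"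
proof -
  note \<Psi> = \<open>young_function \<Psi>\<close> and \<Phi> = \<open>\<Phi> \<in> young_class_Y\<close>
  define \<gamma> where "\<gamma> = \<alpha> + \<beta>"
  have \<gamma>: "0 < \<gamma>" "\<gamma> < DIM(real ^ 'n)" "0 \<le> \<gamma>"
    using assms by (auto simp: \<gamma>_def)
  obtain C where C: "0 < C"
    and inverse_le: "\<And>t. 0 < t \<Longrightarrow>
      t powr (- (\<gamma> / DIM(real ^ 'n))) * young_inverse \<Phi> t \<le> C * young_inverse \<Psi> t"
    using assms(13) by (auto simp: \<gamma>_def)
  obtain L where L: "0 < L"
    and lip: "\<And>c r x y. \<lbrakk>0 < r; x \<in> ball c r; y \<in> ball c r\<rbrakk> \<Longrightarrow>
      \<bar>b x - b y\<bar> \<le> L * measure lebesgue (ball c r) powr (\<beta> / DIM(real ^ 'n))"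
    using lipschitz_space_ball[OF \<open>b \<in> lipschitz_space \<beta>\<close> \<open>0 < \<beta>\<close>] by blast
  have b [measurable]: "b \<in> borel_measurable lebesgue"
    using assms(2) by (rule L1_loc_realD)
  define M where "M = L * (2 * C * 5 ^ DIM(real ^ 'n))"
  have M: "0 < M" using L C by (simp add: M_def)

  \<comment> \<open>The estimate is shown for each admissible scale \<open>l\<close>; the norm of
    \<open>f\<close> enters only afterwards, as the infimum of these scales.\<close>
  have main: "max_commutator \<alpha> b f \<in> L1_loc \<and> weak_orlicz_norm \<Psi> (max_commutator \<alpha> b f) \<le> ennreal M * ennreal l"
    if f: "(\<lambda>x. ereal (f x)) \<in> L1_loc" and l: "0 < l"
      and modular: "(\<integral>\<^sup>+x. \<Phi> (\<bar>f x\<bar> / l) \<partial>lebesgue) \<le> 1"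
    for f :: "real ^ 'n \<Rightarrow> real" and l
  proof -
    note hyps = \<Phi> \<gamma>(3) C inverse_le f l modular
    let ?g = "max_commutator \<alpha> b f"
    have fm [measurable]: "f \<in> borel_measurable lebesgue"
      using f by (rule L1_loc_realD)
    have "AE x in lebesgue. frac_maximal \<alpha> f x < \<infinity>"
      using assms by (intro frac_maximal_finite_AE[OF hyps \<Psi>]) (auto simp: \<gamma>_def)
    then have AE: "AE x in lebesgue. e2ennreal \<bar>?g x\<bar> \<le> ennreal L * frac_maximal \<gamma> f x"
      unfolding \<gamma>_def by eventually_elim (rule max_commutator_bound[OF b fm assms(1) L lip])
    obtain K where K: "\<And>c r. \<lbrakk>0 < r; 1 \<le> measure lebesgue (ball c r)\<rbrakk> \<Longrightarrow> frac_mean \<gamma> f c r \<le> ennreal K"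
      using frac_mean_large_ball[OF hyps \<Psi>] by blast
    have "?g \<in> L1_loc"
      unfolding L1_loc_def
    proof (intro CollectI conjI allI impI)
      show "?g \<in> borel_measurable lebesgue"
        unfolding max_commutator_def[abs_def] by measurable
      fix S :: "(real ^ 'n) set" assume S: "compact S"
      then have [measurable]: "S \<in> sets lebesgue"
        by (intro lmeasurable_compact fmeasurableD)
      have "(\<integral>\<^sup>+x\<in>S. e2ennreal \<bar>?g x\<bar> \<partial>lebesgue)
          \<le> (\<integral>\<^sup>+x. ennreal L * (frac_maximal \<gamma> f x * indicator S x) \<partial>lebesgue)"
        using AE by (intro nn_integral_mono_AE) (auto elim!: eventually_mono simp: indicator_def)
      also have "\<dots> = ennreal L * (\<integral>\<^sup>+x\<in>S. frac_maximal \<gamma> f x \<partial>lebesgue)"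
        by (rule nn_integral_cmult) auto
      also have "\<dots> < \<infinity>"
        using frac_maximal_locally_integrable[OF f \<gamma>(1,2) K S] by (simp add: ennreal_mult_less_top)
      finally show "(\<integral>\<^sup>+x\<in>S. e2ennreal \<bar>?g x\<bar> \<partial>lebesgue) < \<infinity>" .
    qed
    moreover have "weak_orlicz_norm \<Psi> ?g \<le> ennreal (M * l)"
      unfolding weak_orlicz_norm_def
    proof (rule Inf_lower, rule CollectI, intro exI conjI)
      show "0 < M * l" using M l by simp
      show "(SUP t\<in>{0<..}. \<Psi> t * emeasure lebesgue {x. \<bar>?g x\<bar> / ereal (M * l) > ereal t}) \<le> 1"
      proof (rule SUP_least)
        fix t :: real assume "t \<in> {0<..}"
        then have t: "0 < t" by simp
        \<comment> \<open>The threshold of \<open>frac_maximal_weak_bound\<close>; by the choice of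
          \<open>M\<close> it satisfies \<open>L * s = M * l * t\<close>.\<close>
        define s where "s = 2 * C * (5 ^ DIM(real ^ 'n) * t) * l"
        \<comment> \<open>The pointwise bound on the commutator holds only almost everywhere, so the
          level sets are compared up to a null set.\<close>
        have "emeasure lebesgue {x. \<bar>?g x\<bar> / ereal (M * l) > ereal t}
            \<le> emeasure lebesgue {x. ennreal s < frac_maximal \<gamma> f x}"
        proof (rule emeasure_mono_AE)
          show "AE x in lebesgue. x \<in> {x. \<bar>?g x\<bar> / ereal (M * l) > ereal t}
              \<longrightarrow> x \<in> {x. ennreal s < frac_maximal \<gamma> f x}"
            using AE
          proof eventually_elim
            fix x assume le: "e2ennreal \<bar>?g x\<bar> \<le> ennreal L * frac_maximal \<gamma> f x"
            show "x \<in> {x. \<bar>?g x\<bar> / ereal (M * l) > ereal t} \<longrightarrow> x \<in> {x. ennreal s < frac_maximal \<gamma> f x}"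
            proof (intro impI CollectI, rule ccontr)
              assume "x \<in> {x. \<bar>?g x\<bar> / ereal (M * l) > ereal t}"
              then have "ennreal (M * l * t) < e2ennreal \<bar>?g x\<bar>"
                using M l t by (intro ereal_less_divide_abs_imp) auto
              also note le
              also assume "\<not> ennreal s < frac_maximal \<gamma> f x"
              then have "ennreal L * frac_maximal \<gamma> f x \<le> ennreal L * ennreal s"
                by (intro mult_left_mono) auto
              also have "\<dots> = ennreal (M * l * t)"
                using L C l t by (simp add: s_def M_def mult_ac flip: ennreal_mult)
              finally show False by simp
            qed
          qed
          show "{x. ennreal s < frac_maximal \<gamma> f x} \<in> sets lebesgue"
            unfolding frac_maximal_superlevel by (auto intro!: open_sets_lebesgue open_UN)
        qed
        then have "\<Psi> t * emeasure lebesgue {x. \<bar>?g x\<bar> / ereal (M * l) > ereal t}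
            \<le> \<Psi> t * emeasure lebesgue {x. ennreal s < frac_maximal \<gamma> f x}"
          by (rule mult_left_mono) simp
        also have "\<dots> \<le> 1"
          unfolding s_def by (rule frac_maximal_weak_bound[OF hyps \<Psi> t])
        finally show "\<Psi> t * emeasure lebesgue {x. \<bar>?g x\<bar> / ereal (M * l) > ereal t} \<le> 1" .
      qed
    qed simp
    ultimately show ?thesis
      using M l by (simp add: ennreal_mult)
  qed

  have "max_commutator \<alpha> b f \<in> weak_orlicz_space \<Psi>
      \<and> weak_orlicz_norm \<Psi> (max_commutator \<alpha> b f) \<le> ennreal M * orlicz_norm \<Phi> f"
    if f: "f \<in> orlicz_space \<Phi>" for f
  proof
    have fL: "(\<lambda>x. ereal (f x)) \<in> L1_loc"
      using f by (simp add: orlicz_space_def)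
    obtain l where "0 < l" "(\<integral>\<^sup>+x. \<Phi> (\<bar>f x\<bar> / l) \<partial>lebesgue) \<le> 1"
      by (rule orlicz_space_modular_le_1[OF \<Phi> f])
    from main[OF fL this] show "max_commutator \<alpha> b f \<in> weak_orlicz_space \<Psi>"
      unfolding weak_orlicz_space_def
      by (auto intro: le_less_trans simp: ennreal_mult_less_top)
    let ?w = "weak_orlicz_norm \<Psi> (max_commutator \<alpha> b f)"
    \<comment> \<open>Dividing by \<open>M\<close> puts a lower bound of all admissible scales on
      the left, which is what an infimum can be compared with.\<close>
    have "?w / ennreal M \<le> orlicz_norm \<Phi> f"
      unfolding orlicz_norm_def
    proof (rule Inf_greatest, clarify)
      fix l :: real assume "0 < l" "(\<integral>\<^sup>+x. \<Phi> (\<bar>f x\<bar> / l) \<partial>lebesgue) \<le> 1"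
      from main[OF fL this] have "?w / ennreal M \<le> ennreal M * ennreal l / ennreal M"
        by (intro divide_right_mono_ennreal) auto
      also have "\<dots> = ennreal l"
        using M \<open>0 < l\<close> by (simp add: divide_ennreal flip: ennreal_mult)
      finally show "?w / ennreal M \<le> ennreal l" .
    qed
    then have "ennreal M * (?w / ennreal M) \<le> ennreal M * orlicz_norm \<Phi> f"
      by (rule mult_left_mono) simp
    then show "?w \<le> ennreal M * orlicz_norm \<Phi> f"
      using M by (simp add: ennreal_times_divide ennreal_mult_divide_eq mult.commute[of _ ?w])
  qed
  then show ?thesis
    unfolding bounded_operator_def using M by (intro exI[of _ M]) auto
qed

end
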